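(* Let $n\ge 2$, let $\theta_1,\dots,\theta_n>0$, and let $H:\mathbb{R}_+^n\to\mathbb{R}_+^n$ be the quadratic operator $H(x)=x'$ with $$x_k'=\frac{\theta_k x_k}{2}\Big(x_k+2\sum_{i\ne k}x_i\Big),\qquad k=1,\dots,n.$$ The operator $H$ has the following fixed points: (i) $(0,0,\dots,0)\in\mathbb{R}_+^n$; (ii) $(0,\dots,0,\tfrac{2}{\theta_i},0,\dots,0)\in\mathbb{R}_+^n$, whose $i$-th coordinate is non-zero, for any $i=1,\dots,n$; (iii) $(\overline{x}_1,\dots,\overline{x}_n)$, with all coordinates non-zero, where $$\overline{x}_i=\frac{4\theta_i\sum_{1\le i_1<\dots<i_{n-2}\le n,\ i_j\ne i}\theta_{i_1}\cdots\theta_{i_{n-2}}-(4n-6)\prod_{j\ne i}\theta_j}{(2n-1)\prod_{j=1}^n\theta_j},\qquad i=1,\dots,n;$$ (iv) the points for which $r$ coordinates $\widetilde{x}_{s_1},\dots,\widetilde{x}_{s_r}$ are zero and the other $n-r$ coordinates $\widetilde{x}_{s_{r+1}},\dots,\widetilde{x}_{s_n}$ are non-zero, where for $i=r+1,\dots,n$ $$\widetilde{x}_{s_i}=\frac{4\theta_{s_i}\sum_{r+1\le i_1<\dots<i_{n-r-2}\le n,\ i_j\ne i}\theta_{s_{i_1}}\cdots\theta_{s_{i_{n-r-2}}}-(4(n-r)-6)\prod_{r+1\le j\le n,\ j\ne i}\theta_{s_j}}{(2(n-r)-1)\prod_{j=r+1}^n\theta_{s_j}}.$$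
   Context: $\mathbb{R}_+^n=\{x\in\mathbb{R}^n: x_i\ge 0 \text{ for all } i\}$. In (iv), $s_1,\dots,s_n$ is an enumeration of the indices $1,\dots,n$. When $n-2=0$ (resp. $n-r-2=0$) the sum in the formula consists of the single empty product, equal to $1$. *)

theory Defs
  imports "HOL-Analysis.Analysis"
begin

definition nonneg_orthant :: "(real ^ 'n) set" where
  "nonneg_orthant = {x. \<forall>i. 0 \<le> x $ i}"

text \<open>
  The quadratic operator is written as a total function on the whole space; by the lemma
  below it restricts to a self-map of the nonnegative orthant.
\<close>

definition quad_op :: "('n \<Rightarrow> real) \<Rightarrow> real ^ 'n \<Rightarrow> real ^ 'n" where
  "quad_op \<theta> x = (\<chi> k. \<theta> k * x $ k / 2 * (x $ k + 2 * (\<Sum>i\<in>UNIV - {k}. x $ i)))"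

lemma quad_op_nonneg_orthant:
  assumes "\<And>i. \<theta> i > 0"
  shows "quad_op \<theta> ` nonneg_orthant \<subseteq> nonneg_orthant"
  using assms
  by (auto simp: quad_op_def nonneg_orthant_def less_imp_le
      intro!: mult_nonneg_nonneg divide_nonneg_nonneg add_nonneg_nonneg sum_nonneg)

text \<open>
  For an index set \<open>A\<close> with \<open>m = card A\<close>, strictly increasing tuples of \<open>m - 2\<close> indices
  different from \<open>i\<close> are encoded as subsets of \<open>A - {i}\<close> of that size. The definition is meant
  for \<open>m \<ge> 2\<close> only, since \<open>card A - 2\<close> is truncated. For \<open>m = 2\<close> the sum is the empty product 1.
\<close>

definition fp_coord :: "'i set \<Rightarrow> ('i \<Rightarrow> real) \<Rightarrow> 'i \<Rightarrow> real" where
  "fp_coord A \<theta> i =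
     (4 * \<theta> i * (\<Sum>J | J \<subseteq> A - {i} \<and> card J = card A - 2. \<Prod>j\<in>J. \<theta> j)
        - (4 * real (card A) - 6) * (\<Prod>j\<in>A - {i}. \<theta> j))
     / ((2 * real (card A) - 1) * (\<Prod>j\<in>A. \<theta> j))"

definition full_support_point :: "('n \<Rightarrow> real) \<Rightarrow> real ^ 'n \<Rightarrow> bool" where
  "full_support_point \<theta> x \<longleftrightarrow> (\<forall>i. x $ i \<noteq> 0 \<and> x $ i = fp_coord UNIV \<theta> i)"

text \<open>
  Here \<open>s\<close> enumerates the coordinates, and the first \<open>r\<close> coordinates in this enumeration vanish.
\<close>

definition partial_support_point ::
    "('n \<Rightarrow> real) \<Rightarrow> nat \<Rightarrow> (nat \<Rightarrow> 'n) \<Rightarrow> real ^ 'n \<Rightarrow> bool" where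
  "partial_support_point \<theta> r s x \<longleftrightarrow>
     (\<forall>i\<in>{1..r}. x $ s i = 0) \<and>
     (\<forall>i\<in>{r+1..CARD('n)}. x $ s i \<noteq> 0 \<and> x $ s i = fp_coord {r+1..CARD('n)} (\<lambda>j. \<theta> (s j)) i)"

end

theory Submission
  imports Defs
begin

text \<open>
  At an index with \<open>x\<^sub>k \<noteq> 0\<close> the fixed point equation reads \<open>x\<^sub>k = 2 S - 2 / \<theta>\<^sub>k\<close>, where \<open>S\<close> is
  the sum of all coordinates. Summing over the support \<open>A\<close> of \<open>x\<close> determines
  \<open>S = 2 / (2 |A| - 1) \<cdot> (\<Sum>j\<in>A. 1 / \<theta>\<^sub>j)\<close>, so \<open>x\<close> is determined by its support. Dividing the symmetric
  polynomials in the stated formula by \<open>\<Prod>j\<in>A. \<theta>\<^sub>j\<close> turns it into the same expression.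
\<close>

text \<open>A subset missing exactly one element of \<open>B\<close> is some \<open>B - {j}\<close>,
  and its product is the full product divided by \<open>f j\<close>. For empty \<open>B\<close> the
  truncated \<open>card B - 1\<close> would be 0 and the left side 1, against 0 on the
  right.\<close>

lemma sum_prod_card_minus_1_subsets:
  fixes f :: "'i \<Rightarrow> 'b::field"
  assumes "finite B" "B \<noteq> {}" "\<And>j. j \<in> B \<Longrightarrow> f j \<noteq> 0"
  shows "(\<Sum>J | J \<subseteq> B \<and> card J = card B - 1. \<Prod>j\<in>J. f j) = (\<Prod>j\<in>B. f j) * (\<Sum>j\<in>B. 1 / f j)"
proof -
  have "{J. J \<subseteq> B \<and> card J = card B - 1} = (\<lambda>j. B - {j}) ` B"
  proof (intro equalityI subsetI)
    fix J assume "J \<in> {J. J \<subseteq> B \<and> card J = card B - 1}"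
    then have J: "J \<subseteq> B" "card J = card B - 1" by auto
    have "card B > 0" using assms by (simp add: card_gt_0_iff)
    then have "card (B - J) = 1"
      using J assms(1) by (simp add: card_Diff_subset finite_subset)
    then obtain j where "B - J = {j}" by (rule card_1_singletonE)
    then have "j \<in> B" "J = B - {j}" using J by auto
    then show "J \<in> (\<lambda>j. B - {j}) ` B" by blast
  qed (use assms in auto)
  moreover have "inj_on (\<lambda>j. B - {j}) B" by (auto simp: inj_on_def)
  ultimately have "(\<Sum>J | J \<subseteq> B \<and> card J = card B - 1. \<Prod>j\<in>J. f j) = (\<Sum>j\<in>B. prod f (B - {j}))"
    by (simp add: sum.reindex)
  also have "\<dots> = (\<Sum>j\<in>B. prod f B * (1 / f j))"
    using assms by (intro sum.cong) (simp_all add: prod_diff1)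
  finally show ?thesis by (simp add: sum_distrib_left)
qed

text \<open>With \<open>P\<close> the product over \<open>A - {i}\<close>, \<open>T\<close> the sum
  of reciprocals over \<open>A\<close> and \<open>m = card A\<close>, the numerator is
  \<open>4 * \<theta> i * P * T - 4 * P - (4 * m - 6) * P\<close>. The last two terms combine to
  \<open>-2 * (2 * m - 1) * P\<close>, so after division they leave
  \<open>-2 / \<theta> i\<close>.\<close>

lemma fp_coord_eq:
  assumes "finite A" "2 \<le> card A" "i \<in> A" "\<And>j. j \<in> A \<Longrightarrow> \<theta> j \<noteq> 0"
  shows "fp_coord A \<theta> i = 4 * (\<Sum>j\<in>A. 1 / \<theta> j) / (2 * real (card A) - 1) - 2 / \<theta> i"
proof -
  define P T m where "P = (\<Prod>j\<in>A - {i}. \<theta> j)" and "T = (\<Sum>j\<in>A. 1 / \<theta> j)" and "m = real (card A)"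
  have P: "P \<noteq> 0" "(\<Prod>j\<in>A. \<theta> j) = \<theta> i * P"
    using assms by (auto simp: P_def prod.remove)
  \<comment> \<open>Seen from \<open>A - {i}\<close>, the tuples of the formula leave out just one
    index, so the preceding lemma applies.\<close>
  have c: "card (A - {i}) = card A - 1" "card A - 2 = card (A - {i}) - 1"
    using assms by (auto simp: card_Diff_singleton)
  have ne: "A - {i} \<noteq> {}"
  proof
    assume "A - {i} = {}"
    then have "card A \<le> 1" using c(1) by (metis card.empty diff_is_0_eq)
    then show False using assms(2) by simp
  qed
  have T: "(\<Sum>j\<in>A - {i}. 1 / \<theta> j) = T - 1 / \<theta> i"
    using assms by (simp add: T_def sum_diff1)
  have "(\<Sum>J | J \<subseteq> A - {i} \<and> card J = card A - 2. \<Prod>j\<in>J. \<theta> j) = P * (T - 1 / \<theta> i)"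
    unfolding c(2) P_def T[symmetric] using assms ne
    by (intro sum_prod_card_minus_1_subsets) auto
  moreover have "2 * m - 1 \<noteq> 0" and "\<theta> i \<noteq> 0" using assms by (auto simp: m_def)
  ultimately have "fp_coord A \<theta> i =
      (4 * \<theta> i * (P * (T - 1 / \<theta> i)) - (4 * m - 6) * P) / ((2 * m - 1) * (\<theta> i * P))"
    unfolding fp_coord_def P(2) m_def[symmetric] P_def[symmetric] by simp
  also have "\<dots> = 4 * T / (2 * m - 1) - 2 / \<theta> i"
    using P(1) \<open>2 * m - 1 \<noteq> 0\<close> \<open>\<theta> i \<noteq> 0\<close> by (simp add: field_simps)
  finally show ?thesis unfolding T_def m_def .
qed

lemma quad_op_fixed_iff:
  fixes \<theta> :: "'n::finite \<Rightarrow> real"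
  assumes "\<And>i. \<theta> i \<noteq> 0"
  shows "quad_op \<theta> x = x \<longleftrightarrow> (\<forall>k. x $ k \<noteq> 0 \<longrightarrow> x $ k = 2 * (\<Sum>i\<in>UNIV. x $ i) - 2 / \<theta> k)"
proof -
  have "quad_op \<theta> x $ k = x $ k \<longleftrightarrow> (x $ k \<noteq> 0 \<longrightarrow> x $ k = 2 * (\<Sum>i\<in>UNIV. x $ i) - 2 / \<theta> k)" for k
  proof -
    define S where "S = (\<Sum>i\<in>UNIV. x $ i)"
    \<comment> \<open>The bracket in the operator is \<open>x $ k + 2 * (S - x $ k)\<close>. A
      coordinate is thus fixed iff it is zero or its multiplier is 1.\<close>
    have "quad_op \<theta> x $ k = x $ k * (\<theta> k * (2 * S - x $ k) / 2)"
      by (simp add: quad_op_def sum_diff1 S_def algebra_simps)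
    moreover have "\<theta> k * (2 * S - x $ k) / 2 = 1 \<longleftrightarrow> x $ k = 2 * S - 2 / \<theta> k"
      using assms[of k] by (auto simp: field_simps)
    ultimately show ?thesis by (auto simp: S_def)
  qed
  then show ?thesis by (simp add: vec_eq_iff)
qed

text \<open>This removes the unknown total sum from the fixed point equations, leaving only data of
  the support. Any size of the support is allowed, so singletons are covered, where
  \<open>fp_coord\<close> is not meaningful.\<close>

lemma quad_op_fixed_iff_support:
  fixes \<theta> :: "'n::finite \<Rightarrow> real" and x :: "real ^ 'n"
  assumes "\<And>i. \<theta> i \<noteq> 0" and A: "A = {k. x $ k \<noteq> 0}"
  shows "quad_op \<theta> x = x \<longleftrightarrow>
    (\<forall>k\<in>A. x $ k = 4 * (\<Sum>j\<in>A. 1 / \<theta> j) / (2 * real (card A) - 1) - 2 / \<theta> k)"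
proof -
  define S T m where "S = (\<Sum>i\<in>UNIV. x $ i)" and "T = (\<Sum>j\<in>A. 1 / \<theta> j)" and "m = real (card A)"
  \<comment> \<open>A parity argument, valid for empty \<open>A\<close> as well.\<close>
  have m: "2 * m - 1 \<noteq> 0"
  proof
    assume "2 * m - 1 = 0"
    then have "real (2 * card A) = real 1" by (simp add: m_def)
    then have "2 * card A = 1" by (simp only: of_nat_eq_iff)
    then show False by presburger
  qed
  have S: "S = (\<Sum>k\<in>A. x $ k)"
    unfolding S_def A by (rule sum.mono_neutral_right) auto
  \<comment> \<open>Used with two values of \<open>c\<close>: \<open>c = 2 * S\<close> gives a
    linear equation for \<open>S\<close>, and the closed form of \<open>c\<close> gives back
    \<open>c = 2 * S\<close>.\<close>
  have sum_eq: "S = m * c - 2 * T" if "\<forall>k\<in>A. x $ k = c - 2 / \<theta> k" for c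
    using that by (simp add: S T_def m_def sum_subtractf sum_distrib_left)
  have "(\<forall>k\<in>A. x $ k = 2 * S - 2 / \<theta> k) \<longleftrightarrow> (\<forall>k\<in>A. x $ k = 4 * T / (2 * m - 1) - 2 / \<theta> k)"
  proof
    assume x: "\<forall>k\<in>A. x $ k = 2 * S - 2 / \<theta> k"
    have "2 * S = 4 * T / (2 * m - 1)"
      using sum_eq[OF x] m by (simp add: eq_divide_eq) (simp add: algebra_simps)
    with x show "\<forall>k\<in>A. x $ k = 4 * T / (2 * m - 1) - 2 / \<theta> k" by simp
  next
    assume x: "\<forall>k\<in>A. x $ k = 4 * T / (2 * m - 1) - 2 / \<theta> k"
    define c where "c = 4 * T / (2 * m - 1)"
    have "4 * T = c * (2 * m - 1)" using m by (simp add: c_def)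
    then have "c = 2 * S"
      using sum_eq[OF x, folded c_def] by (simp add: algebra_simps)
    with x show "\<forall>k\<in>A. x $ k = 2 * S - 2 / \<theta> k" by (simp add: c_def)
  qed
  then show ?thesis
    using quad_op_fixed_iff[OF assms(1), where x = x] by (simp add: S_def T_def m_def A)
qed

lemma full_support_point_iff:
  fixes \<theta> :: "'n::finite \<Rightarrow> real"
  assumes "2 \<le> CARD('n)" "\<And>i. \<theta> i \<noteq> 0"
  shows "full_support_point \<theta> x \<longleftrightarrow> (\<forall>k. x $ k \<noteq> 0) \<and> quad_op \<theta> x = x"
proof (cases "\<forall>k. x $ k \<noteq> 0")
  case True
  then show ?thesis
    using quad_op_fixed_iff_support[OF assms(2), where A = UNIV and x = x] assms
    by (simp add: full_support_point_def fp_coord_eq)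
qed (auto simp: full_support_point_def)

text \<open>The closed form lives on positions of the enumeration; injectivity of \<open>s\<close>
  carries its sum and cardinality over to the support. The bound on \<open>r\<close> leaves at least
  two positions in the tail, as \<open>fp_coord_eq\<close> requires.\<close>

lemma partial_support_point_iff:
  fixes \<theta> :: "'n::finite \<Rightarrow> real"
  assumes "\<And>i. \<theta> i \<noteq> 0" "r + 2 \<le> CARD('n)" and s: "bij_betw s {1..CARD('n)} UNIV"
  shows "partial_support_point \<theta> r s x \<longleftrightarrow>
    {k. x $ k \<noteq> 0} = s ` {r+1..CARD('n)} \<and> quad_op \<theta> x = x"
proof -
  define I where "I = {r+1..CARD('n)}"
  have I: "finite I" "2 \<le> card I" using assms(2) by (auto simp: I_def)
  have "{1..CARD('n)} = {1..r} \<union> I" using assms(2) by (auto simp: I_def)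
  then have union: "s ` {1..r} \<union> s ` I = UNIV" and inj: "inj_on s ({1..r} \<union> I)"
    using s by (auto simp: bij_betw_def image_Un)
  have "{1..r} \<inter> I = {}" by (auto simp: I_def)
  then have "s ` {1..r} \<inter> s ` I = {}" using inj by (force dest: inj_onD)
  \<comment> \<open>Hence zeros on the head and nonzeros on the tail fix the support
    exactly.\<close>
  then have compl: "s ` {1..r} = - s ` I" using union by blast
  have supp: "{k. x $ k \<noteq> 0} = s ` I \<longleftrightarrow> (\<forall>i\<in>{1..r}. x $ s i = 0) \<and> (\<forall>i\<in>I. x $ s i \<noteq> 0)"
  proof -
    have "{k. x $ k \<noteq> 0} = s ` I \<longleftrightarrow> (\<forall>k\<in>- s ` I. x $ k = 0) \<and> (\<forall>k\<in>s ` I. x $ k \<noteq> 0)"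
      by blast
    then show ?thesis unfolding compl[symmetric] by simp
  qed
  have inj_I: "inj_on s I" using inj by (rule inj_on_subset) auto
  have fp: "fp_coord I (\<lambda>j. \<theta> (s j)) i =
      4 * (\<Sum>j\<in>s ` I. 1 / \<theta> j) / (2 * real (card (s ` I)) - 1) - 2 / \<theta> (s i)" if "i \<in> I" for i
    using fp_coord_eq[of I i "\<lambda>j. \<theta> (s j)"] I that assms(1) inj_I
    by (simp add: sum.reindex card_image)
  show ?thesis
  proof (cases "{k. x $ k \<noteq> 0} = s ` I")
    case True
    have "quad_op \<theta> x = x \<longleftrightarrow> (\<forall>i\<in>I. x $ s i = fp_coord I (\<lambda>j. \<theta> (s j)) i)"
      by (subst quad_op_fixed_iff_support[OF assms(1) True[symmetric]]) (simp add: fp)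
    then show ?thesis
      using True supp unfolding partial_support_point_def I_def[symmetric] by blast
  next
    case False
    then show ?thesis
      using supp unfolding partial_support_point_def I_def[symmetric] by blast
  qed
qed

text \<open>Puts a given support into the shape of \<open>partial_support_point\<close>, zero
  coordinates first: bijections of the two blocks onto \<open>- A\<close> and \<open>A\<close> are
  glued together.\<close>

lemma ex_enumeration_with_tail:
  fixes A :: "'n::finite set"
  obtains s where "bij_betw s {1..CARD('n)} UNIV" "s ` {CARD('n) - card A + 1..CARD('n)} = A"
proof -
  define r where "r = CARD('n) - card A"
  have le: "card A \<le> CARD('n)" by (simp add: card_mono)
  have "card {1..r} = card (- A)" "card {r+1..CARD('n)} = card A"
    using le by (auto simp: r_def Compl_eq_Diff_UNIV card_Diff_subset)
  then obtain f g where f: "bij_betw f {1..r} (- A)" and g: "bij_betw g {r+1..CARD('n)} A"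
    by (metis finite finite_atLeastAtMost finite_same_card_bij)
  define s where "s = (\<lambda>i. if i \<in> {1..r} then f i else g i)"
  have "bij_betw s ({1..r} \<union> {r+1..CARD('n)}) (- A \<union> A)"
    unfolding s_def using f g by (intro bij_betw_disjoint_Un) auto
  moreover have "{1..r} \<union> {r+1..CARD('n)} = {1..CARD('n)}" by (auto simp: r_def)
  moreover have "s ` {r+1..CARD('n)} = g ` {r+1..CARD('n)}"
    by (intro image_cong) (auto simp: s_def)
  ultimately show ?thesis
    using that[of s] bij_betw_imp_surj_on[OF g] by (simp add: r_def)
qed

theorem theorem1:
  fixes \<theta> :: "'n::finite \<Rightarrow> real"
  assumes "CARD('n) \<ge> 2"
    and "\<And>i. \<theta> i > 0"
  shows "(0 :: real ^ 'n) \<in> nonneg_orthant \<and> quad_op \<theta> 0 = 0 \<and>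
    (\<forall>i. axis i (2 / \<theta> i) \<in> nonneg_orthant \<and>
         quad_op \<theta> (axis i (2 / \<theta> i)) = axis i (2 / \<theta> i)) \<and>
    (\<forall>x. full_support_point \<theta> x \<longrightarrow> quad_op \<theta> x = x) \<and>
    (\<forall>r s x. 1 \<le> r \<and> r + 2 \<le> CARD('n) \<and> bij_betw s {1..CARD('n)} UNIV \<and>
         partial_support_point \<theta> r s x \<longrightarrow> quad_op \<theta> x = x) \<and>
    (\<forall>x\<in>nonneg_orthant. quad_op \<theta> x = x \<longrightarrow>
         x = 0 \<or>
         (\<exists>i. x = axis i (2 / \<theta> i)) \<or>
         full_support_point \<theta> x \<or>
         (\<exists>r s. 1 \<le> r \<and> r + 2 \<le> CARD('n) \<and> bij_betw s {1..CARD('n)} UNIV \<and>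
              partial_support_point \<theta> r s x))"
proof -
  have \<theta>: "\<theta> i \<noteq> 0" for i using assms(2)[of i] by simp
  have axis: "axis i (2 / \<theta> i) \<in> nonneg_orthant \<and>
      quad_op \<theta> (axis i (2 / \<theta> i)) = axis i (2 / \<theta> i)" for i
  proof -
    define x where "x = axis i (2 / \<theta> i)"
    have x: "x $ k = (if k = i then 2 / \<theta> i else 0)" for k
      by (auto simp: x_def axis_def)
    have supp: "{i} = {k. x $ k \<noteq> 0}" using \<theta>[of i] by (auto simp: x)
    have "quad_op \<theta> x = x"
      \<comment> \<open>For a singleton support the closed form is
        \<open>4 / \<theta> i - 2 / \<theta> i\<close>.\<close>
      unfolding quad_op_fixed_iff_support[where \<theta> = \<theta>, OF \<theta> supp] by (simp add: x)
    moreover have "x \<in> nonneg_orthant"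
      using assms(2)[of i] by (simp add: nonneg_orthant_def x)
    ultimately show ?thesis by (simp add: x_def)
  qed
  have classify: "x = 0 \<or> (\<exists>i. x = axis i (2 / \<theta> i)) \<or> full_support_point \<theta> x \<or>
      (\<exists>r s. 1 \<le> r \<and> r + 2 \<le> CARD('n) \<and> bij_betw s {1..CARD('n)} UNIV \<and>
        partial_support_point \<theta> r s x)" if fixed: "quad_op \<theta> x = x" for x
  proof -
    define A where "A = {k. x $ k \<noteq> 0}"
    have le: "card A \<le> CARD('n)" by (simp add: card_mono)
    \<comment> \<open>The size of the support decides the kind of fixed point. Size one is kept
      apart because \<open>fp_coord\<close> needs at least two indices.\<close>
    consider "card A = 0" | "card A = 1" | "2 \<le> card A" "card A < CARD('n)" | "card A = CARD('n)"
      using le by linarith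
    then show ?thesis
    proof cases
      case 1
      then have "x = 0" by (auto simp: A_def vec_eq_iff)
      then show ?thesis by simp
    next
      case 2
      then obtain i where i: "A = {i}" by (rule card_1_singletonE)
      then have "x $ i = 2 / \<theta> i"
        using quad_op_fixed_iff_support[where \<theta> = \<theta>, OF \<theta> A_def] fixed by simp
      moreover have "x $ k = 0" if "k \<noteq> i" for k using i that by (auto simp: A_def)
      ultimately have "x = axis i (2 / \<theta> i)" by (auto simp: vec_eq_iff axis_def)
      then show ?thesis by blast
    next
      case 3
      \<comment> \<open>The number of zero coordinates; the two bounds of this case on
        \<open>card A\<close> become those on \<open>r\<close>.\<close>
      define r where "r = CARD('n) - card A"
      have r: "1 \<le> r" "r + 2 \<le> CARD('n)" using 3 by (auto simp: r_def)
      obtain s where s: "bij_betw s {1..CARD('n)} (UNIV :: 'n set)" "s ` {r+1..CARD('n)} = A"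
        unfolding r_def by (rule ex_enumeration_with_tail)
      then have "partial_support_point \<theta> r s x"
        using partial_support_point_iff[where \<theta> = \<theta>, OF \<theta> r(2) s(1)] fixed by (simp add: A_def)
      then show ?thesis using r s(1) by blast
    next
      case 4
      then have "A = UNIV" by (simp add: card_eq_UNIV_imp_eq_UNIV)
      then have "\<forall>k. x $ k \<noteq> 0" by (auto simp: A_def)
      then show ?thesis using full_support_point_iff[where \<theta> = \<theta>, OF assms(1) \<theta>] fixed by blast
    qed
  qed
  have zero: "(0 :: real ^ 'n) \<in> nonneg_orthant" "quad_op \<theta> 0 = 0"
    by (simp_all add: nonneg_orthant_def quad_op_def vec_eq_iff)
  have full: "quad_op \<theta> x = x" if "full_support_point \<theta> x" for x
    using that full_support_point_iff[where \<theta> = \<theta>, OF assms(1) \<theta>] by simp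
  have partial: "quad_op \<theta> x = x"
    if "r + 2 \<le> CARD('n)" "bij_betw s {1..CARD('n)} UNIV" "partial_support_point \<theta> r s x" for r s x
    using that partial_support_point_iff[where \<theta> = \<theta>, OF \<theta> that(1,2)] by simp
  show ?thesis
    using zero axis full partial classify by (intro conjI allI ballI impI) auto
qed

end
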